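(* (1) The rims of the top bowl and of the lower bowl join to the boundary of the Möbius strip $\mathcal M$ in the plane at infinity $\Pi$ of $\mathbb P^3(\mathbb C)$; that is, for each $\theta$ the points of the top bowl, respectively of the lower bowl, with parameters $(r,\theta)$ converge in $\mathbb P^3(\mathbb C)$ as $r\to\infty$ to points of the boundary of $\mathcal M$. (2) The images of the two self-intersection lines under the map $\varphi:K\to R$ are the two edges of the longest length of the $(\sqrt3,\sqrt3,2)$-tetrahedron $\partial R$.
   Context: $\mathbb C^3$ is embedded in $\mathbb P^3(\mathbb C)$ by $(z_1,z_2,z_3)\mapsto(z_1:z_2:z_3:1)$, $\Pi=\mathbb P^3(\mathbb C)\setminus\mathbb C^3$, and $\mathcal M=\{(e^{i\theta}:xe^{i\theta/2}:1:0):0\le\theta<2\pi,\ -2\le x\le2\}\subset\Pi$, with boundary given by $x=\pm2$. Top bowl: the points $z_1=(r^2+r^{-2})e^{-i\theta}+2e^{i\theta}$, $z_2=2(r^2+r^{-2})+2\cos2\theta$, $z_3=(r^2+r^{-2})e^{i\theta}+2e^{-i\theta}$. Lower bowl: the points $z_1=(r^2+r^{-2})e^{-i\theta}-2e^{i\theta}$, $z_2=-2(r^2+r^{-2})+2\cos2\theta$, $z_3=(r^2+r^{-2})e^{i\theta}-2e^{-i\theta}$. Here $\theta\in\mathbb R$ and $r\ge1$. $R_3=\{(z_1,z_2,\bar z_1):z_1\in\mathbb C,z_2\in\mathbb R\}$ has coordinates $(p_1,p_2,q)$, $z_1=p_1+ip_2$, $z_2=q$. Let $R'=\{(\alpha,\beta,\gamma)\in\mathbb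 R^3:-\alpha-\beta-\gamma\le\alpha\le\beta\le\gamma\le2\pi-\alpha-\beta-\gamma\}$. Let $\varphi_1$ send $(\alpha,\beta,\gamma)\in R'$ to the point of $R_3$ with $z_1=e^{i\alpha}+e^{i\beta}+e^{i\gamma}+e^{-i(\alpha+\beta+\gamma)}$ and $z_2=$ the second elementary symmetric function of these four exponentials; it is a bijection of $R'$ onto its image $K$, which equals the set of points of $\mathbb C^3$ with bounded orbit under $P_{A_3}^d$ (the map determined by $P_{A_3}^d(\Phi_1(t_1,t_2,t_3))=\Phi_1(t_1^d,t_2^d,t_3^d)$, with $\Phi_1(t_1,t_2,t_3)$ the first three elementary symmetric functions of $t_1,t_2,t_3,1/(t_1t_2t_3)$). Let $T(\alpha,\beta,\gamma)=\big(\tfrac{-\alpha+\beta}2,\ -\tfrac{\alpha+\beta}{\sqrt2},\ \tfrac{\alpha+\beta}2+\gamma\big)$. Then $R=T(R')$ is the closed region bounded by the tetrahedron with vertices $O=(0,0,0)$, $A_1=(0,-\pi/\sqrt2,\pi)$, $A_2=(\pi,0,\pi)$, $A_3=(0,\pi/\sqrt2,\pi)$, and $\varphi=T\circ\varphi_1^{-1}:K\to R$. A $(\sqrt3,\sqrt3,2)$-tetrahedron is one with four mutually congruent faces whose edge lengths are in ratio $\sqrt3:\sqrt3:2$. The boundary of $K$ is the ruled surface $\mathcal A=\{(4\cos^3u,4\sin^3u,6\cos2u)+v(\cos u,-\sin u,2):0\le u<2\pi,\ -2-2\cos2u\le v\le2-2\cos2u\}$ in $(p_1,p_2,q)$-coordinates.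 Its two self-intersection lines (the upper and the lower one) are the curves of points of the top bowl and of the lower bowl, respectively, with $r=1$: $\{(4\cos\theta,0,4+2\cos2\theta)\}$ and $\{(0,-4\sin\theta,-4+2\cos2\theta)\}$ in $(p_1,p_2,q)$-coordinates. *)

theory Defs
  imports "HOL-Analysis.Analysis"
begin

section \<open>Complex projective 3-space\<close>

definition proj_rel :: "complex^4 \<Rightarrow> complex^4 \<Rightarrow> bool" where
  "proj_rel v w \<longleftrightarrow> v \<noteq> 0 \<and> (\<exists>c. c \<noteq> 0 \<and> w = c *s v)"

lemma proj_rel_part_equivp: "part_equivp proj_rel"
proof (rule part_equivpI)
  show "\<exists>v. proj_rel v v"
    by (intro exI[of _ "1 :: complex^4"]) (auto simp: proj_rel_def intro: exI[of _ 1])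
  show "symp proj_rel"
  proof (rule sympI)
    fix v w :: "complex^4"
    assume "proj_rel v w"
    then obtain c where c: "v \<noteq> 0" "c \<noteq> 0" "w = c *s v"
      by (auto simp: proj_rel_def)
    then have "w \<noteq> 0" "v = inverse c *s w"
      by (auto simp: vec_eq_iff)
    with c show "proj_rel w v"
      unfolding proj_rel_def by (metis inverse_nonzero_iff_nonzero)
  qed
  show "transp proj_rel"
  proof (rule transpI)
    fix u v w :: "complex^4"
    assume "proj_rel u v" "proj_rel v w"
    then obtain c d where "u \<noteq> 0" "c \<noteq> 0" "v = c *s u" "d \<noteq> 0" "w = d *s v"
      by (auto simp: proj_rel_def)
    then show "proj_rel u w"
      unfolding proj_rel_def by (auto intro!: exI[of _ "d * c"])
  qed
qed

quotient_type proj3 = "complex^4" / partial: proj_rel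
  by (rule proj_rel_part_equivp)

text \<open>The topology is the quotient topology of \<open>complex^4 - {0}\<close>. On the zero vector,
  \<^const>\<open>abs_proj3\<close> has no meaning, hence the exclusion.\<close>

instantiation proj3 :: topological_space
begin

definition open_proj3 :: "proj3 set \<Rightarrow> bool" where
  "open_proj3 U \<longleftrightarrow> open {v. v \<noteq> 0 \<and> abs_proj3 v \<in> U}"

instance
proof
  show "open (UNIV :: proj3 set)"
    using open_Collect_neq[of "\<lambda>v::complex^4. v" "\<lambda>_. 0"]
    by (simp add: open_proj3_def)
next
  fix S T :: "proj3 set"
  assume "open S" "open T"
  moreover have "{v. v \<noteq> 0 \<and> abs_proj3 v \<in> S \<inter> T} =
      {v. v \<noteq> 0 \<and> abs_proj3 v \<in> S} \<inter> {v. v \<noteq> 0 \<and> abs_proj3 v \<in> T}"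
    by auto
  ultimately show "open (S \<inter> T)"
    by (simp only: open_proj3_def open_Int)
next
  fix K :: "proj3 set set"
  assume "\<forall>S\<in>K. open S"
  moreover have "{v. v \<noteq> 0 \<and> abs_proj3 v \<in> \<Union>K} = (\<Union>S\<in>K. {v. v \<noteq> 0 \<and> abs_proj3 v \<in> S})"
    by auto
  ultimately show "open (\<Union>K)"
    by (simp only: open_proj3_def open_UN)
qed

end

text \<open>\<open>hom_point a b c d\<close> is the point \<open>(a : b : c : d)\<close>.\<close>

definition hom_point :: "complex \<Rightarrow> complex \<Rightarrow> complex \<Rightarrow> complex \<Rightarrow> proj3" where
  "hom_point a b c d = abs_proj3 (vector [a, b, c, d])"

definition embed_C3 :: "complex^3 \<Rightarrow> proj3" where
  "embed_C3 z = hom_point (z$1) (z$2) (z$3) 1"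

definition plane_at_infinity :: "proj3 set" where
  "plane_at_infinity = - range embed_C3"

lemma vector_4:
  fixes a b c d :: "'a::zero"
  shows "(vector [a, b, c, d] :: 'a^4)$1 = a" "(vector [a, b, c, d] :: 'a^4)$2 = b"
    "(vector [a, b, c, d] :: 'a^4)$3 = c" "(vector [a, b, c, d] :: 'a^4)$4 = d"
  unfolding vector_def by simp_all

lemma hom_point_eq_iff:
  assumes "(a, b, c, d) \<noteq> (0, 0, 0, 0)" "(a', b', c', d') \<noteq> (0, 0, 0, 0)"
  shows "hom_point a b c d = hom_point a' b' c' d' \<longleftrightarrow>
    (\<exists>k. k \<noteq> 0 \<and> a' = k * a \<and> b' = k * b \<and> c' = k * c \<and> d' = k * d)"
proof -
  have nz: "(vector [x, y, z, t] :: complex^4) \<noteq> 0" if "(x, y, z, t) \<noteq> (0, 0, 0, 0)" for x y z t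
    using that by (auto simp: vec_eq_iff forall_4 vector_4)
  have refl: "proj_rel v v" if "v \<noteq> 0" for v
    using that by (auto simp: proj_rel_def intro!: exI[of _ 1])
  have "hom_point a b c d = hom_point a' b' c' d' \<longleftrightarrow>
      proj_rel (vector [a, b, c, d]) (vector [a', b', c', d'])"
    unfolding hom_point_def
    using Quotient3_rel[OF Quotient3_proj3, of "vector [a, b, c, d]" "vector [a', b', c', d']"]
      refl[OF nz[OF assms(1)]] refl[OF nz[OF assms(2)]] by simp
  also have "\<dots> \<longleftrightarrow> (\<exists>k. k \<noteq> 0 \<and>
      (vector [a', b', c', d'] :: complex^4) = k *s vector [a, b, c, d])"
    using nz[OF assms(1)] by (simp only: proj_rel_def) simp
  also have "\<dots> \<longleftrightarrow> (\<exists>k. k \<noteq> 0 \<and> a' = k * a \<and> b' = k * b \<and> c' = k * c \<and> d' = k * d)"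
    by (simp add: vec_eq_iff forall_4 vector_4)
  finally show ?thesis .
qed


section \<open>The Moebius strip at infinity\<close>

definition moebius_point :: "real \<Rightarrow> real \<Rightarrow> proj3" where
  "moebius_point \<theta> x = hom_point (cis \<theta>) (of_real x * cis (\<theta>/2)) 1 0"

definition moebius_strip :: "proj3 set" where
  "moebius_strip = {moebius_point \<theta> x |\<theta> x. 0 \<le> \<theta> \<and> \<theta> < 2*pi \<and> -2 \<le> x \<and> x \<le> 2}"

definition moebius_boundary :: "proj3 set" where
  "moebius_boundary = {moebius_point \<theta> x |\<theta> x. 0 \<le> \<theta> \<and> \<theta> < 2*pi \<and> (x = -2 \<or> x = 2)}"

lemma moebius_strip_at_infinity: "moebius_strip \<subseteq> plane_at_infinity"
  by (auto simp: moebius_strip_def plane_at_infinity_def moebius_point_def embed_C3_def hom_point_eq_iff)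

lemma moebius_boundary_subset: "moebius_boundary \<subseteq> moebius_strip"
  unfolding moebius_boundary_def moebius_strip_def by fastforce


section \<open>The two bowls and the self-intersection lines of the boundary of \<open>K\<close>\<close>

definition top_bowl :: "real \<Rightarrow> real \<Rightarrow> complex^3" where
  "top_bowl r \<theta> = vector
    [of_real (r^2 + 1/r^2) * cis (-\<theta>) + 2 * cis \<theta>,
     of_real (2 * (r^2 + 1/r^2) + 2 * cos (2*\<theta>)),
     of_real (r^2 + 1/r^2) * cis \<theta> + 2 * cis (-\<theta>)]"

definition lower_bowl :: "real \<Rightarrow> real \<Rightarrow> complex^3" where
  "lower_bowl r \<theta> = vector
    [of_real (r^2 + 1/r^2) * cis (-\<theta>) - 2 * cis \<theta>,
     of_real (- 2 * (r^2 + 1/r^2) + 2 * cos (2*\<theta>)),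
     of_real (r^2 + 1/r^2) * cis \<theta> - 2 * cis (-\<theta>)]"

definition upper_line :: "(complex^3) set" where
  "upper_line = {top_bowl 1 \<theta> |\<theta>. True}"

definition lower_line :: "(complex^3) set" where
  "lower_line = {lower_bowl 1 \<theta> |\<theta>. True}"

text \<open>The point of \<open>R\<^sub>3\<close> with real coordinates \<open>(p\<^sub>1, p\<^sub>2, q)\<close>.\<close>

definition R3_point :: "real \<Rightarrow> real \<Rightarrow> real \<Rightarrow> complex^3" where
  "R3_point p1 p2 q = vector [Complex p1 p2, of_real q, Complex p1 (-p2)]"

lemma R3_point_eq_iff:
  "R3_point a b c = R3_point a' b' c' \<longleftrightarrow> a = a' \<and> b = b' \<and> c = c'"
  by (auto simp: R3_point_def vec_eq_iff forall_3)

lemma top_bowl_1: "top_bowl 1 \<theta> = R3_point (4 * cos \<theta>) 0 (4 + 2 * cos (2*\<theta>))"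
  by (auto simp: top_bowl_def R3_point_def vec_eq_iff forall_3 complex_eq_iff)

lemma lower_bowl_1: "lower_bowl 1 \<theta> = R3_point 0 (-4 * sin \<theta>) (-4 + 2 * cos (2*\<theta>))"
  by (auto simp: lower_bowl_def R3_point_def vec_eq_iff forall_3 complex_eq_iff)

definition ruled_point :: "real \<times> real \<Rightarrow> complex^3" where
  "ruled_point = (\<lambda>(u, v). R3_point (4 * cos u ^ 3 + v * cos u) (4 * sin u ^ 3 - v * sin u)
                                     (6 * cos (2*u) + 2 * v))"

definition ruled_domain :: "(real \<times> real) set" where
  "ruled_domain = {(u, v). 0 \<le> u \<and> u < 2*pi \<and> -2 - 2 * cos (2*u) \<le> v \<and> v \<le> 2 - 2 * cos (2*u)}"

definition ruled_surface :: "(complex^3) set" where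
  "ruled_surface = ruled_point ` ruled_domain"

definition double_points :: "(complex^3) set" where
  "double_points = {ruled_point a |a b. a \<in> ruled_domain \<and> b \<in> ruled_domain \<and>
                                        a \<noteq> b \<and> ruled_point a = ruled_point b}"


text \<open>The lines are the self-intersection of the ruled surface. The double points of the parametrised surface are the points of the two lines, except for
  the two end points of each line, which are only limits of double points.\<close>

lemma ruled_point_eq:
  "ruled_point (u, 2 - 2 * cos (2*u)) = R3_point (4 * cos u) 0 (4 + 2 * cos (2*u))"
  "ruled_point (u, -2 - 2 * cos (2*u)) = R3_point 0 (4 * sin u) (-4 + 2 * cos (2*u))"
proof -
  have c: "cos (2*u) = 2 * (cos u)^2 - 1" "cos (2*u) = 1 - 2 * (sin u)^2"
    by (rule cos_double_cos, rule cos_double_sin)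
  have "4 * cos u ^ 3 + (2 - 2 * cos (2*u)) * cos u = 4 * cos u"
    unfolding c(1) by (simp add: algebra_simps power2_eq_square power3_eq_cube)
  moreover have "4 * sin u ^ 3 - (2 - 2 * cos (2*u)) * sin u = 0"
    unfolding c(2) by (simp add: algebra_simps power2_eq_square power3_eq_cube)
  moreover have "4 * cos u ^ 3 + (-2 - 2 * cos (2*u)) * cos u = 0"
    unfolding c(1) by (simp add: algebra_simps power2_eq_square power3_eq_cube)
  moreover have "4 * sin u ^ 3 - (-2 - 2 * cos (2*u)) * sin u = 4 * sin u"
    unfolding c(2) by (simp add: algebra_simps power2_eq_square power3_eq_cube)
  ultimately show "ruled_point (u, 2 - 2 * cos (2*u)) = R3_point (4 * cos u) 0 (4 + 2 * cos (2*u))"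
    "ruled_point (u, -2 - 2 * cos (2*u)) = R3_point 0 (4 * sin u) (-4 + 2 * cos (2*u))"
    by (simp_all add: ruled_point_def R3_point_eq_iff)
qed

lemma double_points_subset: "double_points \<subseteq> upper_line \<union> lower_line"
proof
  fix p assume "p \<in> double_points"
  then obtain u v u' v' where p: "p = ruled_point (u, v)"
    and dom: "(u, v) \<in> ruled_domain" "(u', v') \<in> ruled_domain"
    and ne: "(u, v) \<noteq> (u', v')" and eq: "ruled_point (u, v) = ruled_point (u', v')"
    unfolding double_points_def by auto
  define t where "t = 2 * cos (2*u) + v"
  define t' where "t' = 2 * cos (2*u') + v'"
  have v: "v = t - 2 * cos (2*u)" "v' = t' - 2 * cos (2*u')"
    by (simp_all add: t_def t'_def)
  have red: "4 * cos x ^ 3 + (s - 2 * cos (2*x)) * cos x = (2 + s) * cos x"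
    "4 * sin x ^ 3 - (s - 2 * cos (2*x)) * sin x = (2 - s) * sin x" for s x :: real
  proof -
    show "4 * cos x ^ 3 + (s - 2 * cos (2*x)) * cos x = (2 + s) * cos x"
      unfolding cos_double_cos by (simp add: algebra_simps power2_eq_square power3_eq_cube)
    show "4 * sin x ^ 3 - (s - 2 * cos (2*x)) * sin x = (2 - s) * sin x"
      unfolding cos_double_sin by (simp add: algebra_simps power2_eq_square power3_eq_cube)
  qed
  have e: "(2 + t) * cos u = (2 + t') * cos u'" "(2 - t) * sin u = (2 - t') * sin u'"
    "cos (2*u) + t = cos (2*u') + t'"
    using eq by (simp_all add: ruled_point_def R3_point_eq_iff v red)
  have "u \<noteq> u'"
    using e(3) ne v by auto
  define m where "m = (u + u') / 2"
  define d where "d = (u - u') / 2"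
  have u: "u = m + d" "u' = m - d"
    by (simp_all add: m_def d_def field_simps)
  have "\<bar>d\<bar> < pi" "d \<noteq> 0"
    using dom \<open>u \<noteq> u'\<close> by (auto simp: d_def ruled_domain_def abs_less_iff)
  then have sd: "sin d \<noteq> 0"
    using sin_eq_0_pi[of d] by (auto simp: abs_less_iff)
  have r: "- 4 * sin d * sin (2*m) = cos d * (t' - t)"
    using e(1,2) sin_cos_squared_add[of m]
    unfolding u sin_add cos_add sin_diff cos_diff sin_double by algebra
  have i: "4 * sin d * cos (2*m) = sin d * (t + t')"
    using e(1,2) sin_cos_squared_add[of m]
    unfolding u sin_add cos_add sin_diff cos_diff cos_double by algebra
  have "t' - t = cos (2*m + 2*d) - cos (2*m - 2*d)"
    using e(3) unfolding u by (simp add: algebra_simps)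
  also have "\<dots> = - 4 * sin (2*m) * sin d * cos d"
    unfolding cos_add cos_diff sin_double[of d] by algebra
  finally have tt: "t' - t = - 4 * sin (2*m) * sin d * cos d" .
  have "sin d ^ 3 * sin (2*m) = 0"
    using r tt sin_cos_squared_add[of d] by algebra
  then have s0: "sin (2*m) = 0"
    using sd by simp
  then have "t = t'"
    using tt by simp
  with i sd have "t = 2 * cos (2*m)"
    by simp
  moreover have "cos (2*m) = 1 \<or> cos (2*m) = -1"
    using s0 sin_cos_squared_add[of "2*m"] by (simp add: power2_eq_1_iff)
  ultimately have "t = 2 \<or> t = -2"
    by auto
  then show "p \<in> upper_line \<union> lower_line"
  proof
    assume "t = 2"
    then show ?thesis
      using p v ruled_point_eq(1)[of u] by (auto simp: upper_line_def top_bowl_1)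
  next
    assume "t = -2"
    then have "p = lower_bowl 1 (-u)"
      using p v ruled_point_eq(2)[of u] by (simp add: lower_bowl_1)
    then show ?thesis
      by (auto simp: lower_line_def)
  qed
qed

lemma double_pointsI:
  assumes "p = ruled_point a" "p = ruled_point b" "a \<in> ruled_domain" "b \<in> ruled_domain" "a \<noteq> b"
  shows "p \<in> double_points"
  using assms unfolding double_points_def by (intro CollectI exI[of _ a] exI[of _ b]) simp

lemma double_points_top:
  assumes "sin \<theta> \<noteq> 0"
  shows "top_bowl 1 \<theta> \<in> double_points"
proof -
  obtain u where u: "0 \<le> u" "u < 2*pi" "cos \<theta> = cos u" "sin \<theta> = sin u"
    by (rule sincos_total_2pi[of "cos \<theta>" "sin \<theta>"], simp, assumption)
  obtain u' where u': "0 \<le> u'" "u' < 2*pi" "cos \<theta> = cos u'" "- sin \<theta> = sin u'"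
    by (rule sincos_total_2pi[of "cos \<theta>" "- sin \<theta>"], simp, assumption)
  have "u \<noteq> u'"
  proof
    assume "u = u'"
    then have "sin u = sin u'" by (rule arg_cong)
    with u(4) u'(4) assms show False by linarith
  qed
  have c: "cos (2*u) = cos (2*\<theta>)" "cos (2*u') = cos (2*\<theta>)"
    unfolding cos_double_cos u(3)[symmetric] u'(3)[symmetric] by simp_all
  have "top_bowl 1 \<theta> = ruled_point (u, 2 - 2 * cos (2*u))"
    "top_bowl 1 \<theta> = ruled_point (u', 2 - 2 * cos (2*u'))"
    unfolding top_bowl_1 ruled_point_eq unfolding c u(3)[symmetric] u'(3)[symmetric]
    by (rule refl)+
  moreover have "(u, 2 - 2 * cos (2*u)) \<in> ruled_domain" "(u', 2 - 2 * cos (2*u')) \<in> ruled_domain"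
    using u(1,2) u'(1,2) by (simp_all add: ruled_domain_def)
  moreover note \<open>u \<noteq> u'\<close>
  ultimately show ?thesis
    by (metis double_pointsI prod.inject)
qed

lemma double_points_lower:
  assumes "cos \<theta> \<noteq> 0"
  shows "lower_bowl 1 \<theta> \<in> double_points"
proof -
  obtain u where u: "0 \<le> u" "u < 2*pi" "cos \<theta> = cos u" "- sin \<theta> = sin u"
    by (rule sincos_total_2pi[of "cos \<theta>" "- sin \<theta>"], simp, assumption)
  obtain u' where u': "0 \<le> u'" "u' < 2*pi" "- cos \<theta> = cos u'" "- sin \<theta> = sin u'"
    by (rule sincos_total_2pi[of "- cos \<theta>" "- sin \<theta>"], simp, assumption)
  have "u \<noteq> u'"
  proof
    assume "u = u'"
    then have "cos u = cos u'" by (rule arg_cong)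
    with u(3) u'(3) assms show False by linarith
  qed
  have c: "cos (2*u) = cos (2*\<theta>)" "cos (2*u') = cos (2*\<theta>)"
    unfolding cos_double_cos u(3)[symmetric] u'(3)[symmetric] by simp_all
  have s: "4 * sin u = -4 * sin \<theta>" "4 * sin u' = -4 * sin \<theta>"
    using u(4) u'(4) by linarith+
  have "lower_bowl 1 \<theta> = ruled_point (u, -2 - 2 * cos (2*u))"
    "lower_bowl 1 \<theta> = ruled_point (u', -2 - 2 * cos (2*u'))"
    unfolding lower_bowl_1 ruled_point_eq unfolding c s by (rule refl)+
  moreover have "(u, -2 - 2 * cos (2*u)) \<in> ruled_domain" "(u', -2 - 2 * cos (2*u')) \<in> ruled_domain"
    using u(1,2) u'(1,2) by (simp_all add: ruled_domain_def)
  moreover note \<open>u \<noteq> u'\<close>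
  ultimately show ?thesis
    by (metis double_pointsI prod.inject)
qed

lemma continuous_on_R3_point:
  assumes "continuous_on S f" "continuous_on S g" "continuous_on S h"
  shows "continuous_on S (\<lambda>x. R3_point (f x) (g x) (h x))"
proof -
  have "R3_point a b c =
      (\<chi> i. if i = 1 then Complex a b else if i = 2 then of_real c else Complex a (-b))" for a b c
    by (simp add: R3_point_def vec_eq_iff forall_3)
  moreover have "continuous_on S (\<lambda>x. if i = 1 then Complex (f x) (g x)
      else if i = 2 then of_real (h x) else Complex (f x) (- g x))" for i :: 3
    using assms unfolding Complex_eq
    by (cases "i = 1"; cases "i = 2") (simp_all add: continuous_intros)
  ultimately show ?thesis
    by (simp add: continuous_on_vec_lambda)
qed

lemma continuous_on_top_bowl_1: "continuous_on S (top_bowl 1)"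
  unfolding top_bowl_1[abs_def] by (intro continuous_on_R3_point continuous_intros)

lemma continuous_on_lower_bowl_1: "continuous_on S (lower_bowl 1)"
  unfolding lower_bowl_1[abs_def] by (intro continuous_on_R3_point continuous_intros)

lemma closed_lines: "closed upper_line" "closed lower_line"
proof -
  have "\<exists>t\<in>{0..2*pi}. top_bowl 1 \<theta> = top_bowl 1 t \<and> lower_bowl 1 \<theta> = lower_bowl 1 t" for \<theta>
  proof -
    obtain t where t: "0 \<le> t" "t < 2*pi" "cos \<theta> = cos t" "sin \<theta> = sin t"
      by (rule sincos_total_2pi[of "cos \<theta>" "sin \<theta>"], simp, assumption)
    have "top_bowl 1 \<theta> = top_bowl 1 t" "lower_bowl 1 \<theta> = lower_bowl 1 t"
      unfolding top_bowl_1 lower_bowl_1 cos_double_cos t(3,4) by (rule refl)+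
    with t show ?thesis
      by (intro bexI[of _ t]) auto
  qed
  then have eq: "upper_line = top_bowl 1 ` {0..2*pi}" "lower_line = lower_bowl 1 ` {0..2*pi}"
    unfolding upper_line_def lower_line_def by blast+
  show "closed upper_line" "closed lower_line"
    unfolding eq by (intro compact_imp_closed compact_continuous_image continuous_on_top_bowl_1
        continuous_on_lower_bowl_1 compact_Icc)+
qed

lemma closure_double_points: "closure double_points = upper_line \<union> lower_line"
proof
  show "closure double_points \<subseteq> upper_line \<union> lower_line"
    by (intro closure_minimal double_points_subset closed_Un closed_lines)
  have dense: "closure (- C) = UNIV" if "countable C" for C :: "real set"
  proof -
    have "interior C - C \<noteq> {}" if "interior C \<noteq> {}"
      using open_minus_countable[OF \<open>countable C\<close> that open_interior] by blast
    then show ?thesis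
      using interior_subset[of C] by (auto simp: closure_complement)
  qed
  have "countable {\<theta> :: real. sin \<theta> = 0}"
    by (rule countable_subset[of _ "range (\<lambda>i::int. of_int i * pi)"]) (auto simp: sin_zero_iff_int2)
  then have "closure {\<theta> :: real. sin \<theta> \<noteq> 0} = UNIV"
    using dense[of "{\<theta>. sin \<theta> = 0}"] by (simp add: Collect_neg_eq)
  then have 1: "top_bowl 1 ` UNIV \<subseteq> closure double_points"
    using image_closure_subset[of "{\<theta> :: real. sin \<theta> \<noteq> 0}" "top_bowl 1" "closure double_points"]
      double_points_top closure_subset continuous_on_top_bowl_1 by auto
  have "{\<theta> :: real. cos \<theta> = 0} \<subseteq> range (\<lambda>i::int. of_int i * (pi/2))"
    by (auto simp: cos_zero_iff_int)
  then have "countable {\<theta> :: real. cos \<theta> = 0}"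
    by (rule countable_subset) auto
  then have "closure {\<theta> :: real. cos \<theta> \<noteq> 0} = UNIV"
    using dense[of "{\<theta>. cos \<theta> = 0}"] by (simp add: Collect_neg_eq)
  then have 2: "lower_bowl 1 ` UNIV \<subseteq> closure double_points"
    using image_closure_subset[of "{\<theta> :: real. cos \<theta> \<noteq> 0}" "lower_bowl 1" "closure double_points"]
      double_points_lower closure_subset continuous_on_lower_bowl_1 by auto
  show "upper_line \<union> lower_line \<subseteq> closure double_points"
    using 1 2 by (auto simp: upper_line_def lower_line_def)
qed


section \<open>The body \<open>K\<close> and the tetrahedron \<open>R\<close>\<close>

definition R'_set :: "(real^3) set" where
  "R'_set = {p. let \<alpha> = p$1; \<beta> = p$2; \<gamma> = p$3 in
          - \<alpha> - \<beta> - \<gamma> \<le> \<alpha> \<and> \<alpha> \<le> \<beta> \<and> \<beta> \<le> \<gamma> \<and> \<gamma> \<le> 2*pi - \<alpha> - \<beta> - \<gamma>}"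

text \<open>The point of \<open>R\<^sub>3\<close> with prescribed \<open>z\<^sub>1\<close> and \<open>z\<^sub>2\<close>; its third coordinate is the conjugate
  of \<open>z\<^sub>1\<close>.\<close>

definition phi1 :: "real^3 \<Rightarrow> complex^3" where
  "phi1 p = (let t1 = cis (p$1); t2 = cis (p$2); t3 = cis (p$3); t4 = cis (- (p$1 + p$2 + p$3));
               z1 = t1 + t2 + t3 + t4;
               z2 = t1*t2 + t1*t3 + t1*t4 + t2*t3 + t2*t4 + t3*t4
           in vector [z1, z2, cnj z1])"

definition K_set :: "(complex^3) set" where
  "K_set = phi1 ` R'_set"

definition T_map :: "real^3 \<Rightarrow> real^3" where
  "T_map p = (let \<alpha> = p$1; \<beta> = p$2; \<gamma> = p$3 in
           vector [(-\<alpha> + \<beta>) / 2, - (\<alpha> + \<beta>) / sqrt 2, (\<alpha> + \<beta>) / 2 + \<gamma>])"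

definition R_set :: "(real^3) set" where
  "R_set = T_map ` R'_set"

lemma phi1_R3_point:
  "phi1 (vector [a, b, c]) = R3_point
     (cos a + cos b + cos c + cos (a + b + c)) (sin a + sin b + sin c - sin (a + b + c)) q"
  if "cis a * cis b + cis a * cis c + cis a * cis (- (a + b + c)) + cis b * cis c
      + cis b * cis (- (a + b + c)) + cis c * cis (- (a + b + c)) = complex_of_real q"
proof -
  have "cis a + cis b + cis c + cis (- (a + b + c)) =
      Complex (cos a + cos b + cos c + cos (a + b + c)) (sin a + sin b + sin c - sin (a + b + c))"
    unfolding complex_eq_iff plus_complex.sel cis.sel complex.sel cos_minus sin_minus by simp
  with that show ?thesis
    unfolding phi1_def R3_point_def Let_def vector_3 by (simp only: complex_cnj)
qed

lemma lines_subset_K: "upper_line \<subseteq> K_set" "lower_line \<subseteq> K_set"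
proof -
  have "top_bowl 1 \<theta> \<in> K_set" for \<theta>
  proof -
    define t where "t = arccos (cos \<theta>)"
    have t: "0 \<le> t" "t \<le> pi" "cos t = cos \<theta>"
      by (auto simp: t_def arccos_lbound arccos_ubound)
    have "cis (-t) * cis t + cis (-t) * cis t + cis (-t) * cis (- (-t + t + t)) + cis t * cis t
        + cis t * cis (- (-t + t + t)) + cis t * cis (- (-t + t + t)) =
        complex_of_real (4 + 2 * cos (2*t))"
      unfolding cis_mult complex_eq_iff by simp
    from phi1_R3_point[OF this] have "phi1 (vector [-t, t, t]) = top_bowl 1 \<theta>"
      unfolding top_bowl_1 cos_double_cos t(3)[symmetric] by simp
    moreover have "vector [-t, t, t] \<in> R'_set"
      using t unfolding R'_set_def Let_def mem_Collect_eq vector_3 by linarith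
    ultimately show ?thesis
      unfolding K_set_def by (metis imageI)
  qed
  then show "upper_line \<subseteq> K_set"
    by (auto simp: upper_line_def)
  have "lower_bowl 1 \<theta> \<in> K_set" for \<theta>
  proof -
    define t where "t = arcsin (- sin \<theta>)"
    have t: "-(pi/2) \<le> t" "t \<le> pi/2" "sin t = - sin \<theta>"
      unfolding t_def by (rule arcsin_lbound arcsin_ubound sin_arcsin; simp)+
    have "cis t * cis t + cis t * cis (pi - t) + cis t * cis (- (t + t + (pi - t)))
        + cis t * cis (pi - t) + cis t * cis (- (t + t + (pi - t)))
        + cis (pi - t) * cis (- (t + t + (pi - t))) =
        complex_of_real (-4 + 2 * cos (2*t))"
      unfolding cis_mult complex_eq_iff
      by (simp add: cos_diff[of "- (2*t)" "2*pi"] cos_minus[of "2*t"])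
    from phi1_R3_point[OF this] have "phi1 (vector [t, t, pi - t]) = lower_bowl 1 \<theta>"
      unfolding lower_bowl_1 cos_double_sin t(3) by (simp add: t(3))
    moreover have "vector [t, t, pi - t] \<in> R'_set"
      using t(1,2) unfolding R'_set_def Let_def mem_Collect_eq vector_3 by linarith
    ultimately show ?thesis
      unfolding K_set_def by (metis imageI)
  qed
  then show "lower_line \<subseteq> K_set"
    by (auto simp: lower_line_def)
qed

text \<open>Meaningful on \<^const>\<open>K_set\<close> only, where \<^const>\<open>phi1\<close> has a unique preimage in \<^const>\<open>R'_set\<close>.\<close>

definition phi :: "complex^3 \<Rightarrow> real^3" where
  "phi = T_map \<circ> inv_into R'_set phi1"


section \<open>Tetrahedra\<close>

definition congruent_sets :: "'a::metric_space set \<Rightarrow> 'a set \<Rightarrow> bool" where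
  "congruent_sets F G \<longleftrightarrow> (\<exists>f. (\<forall>x y. dist (f x) (f y) = dist x y) \<and> f ` F = G)"

text \<open>The predicate is about the solid body; the tetrahedral surface is its frontier.\<close>

definition sqrt3_sqrt3_2_tetrahedron :: "(real^3) set \<Rightarrow> bool" where
  "sqrt3_sqrt3_2_tetrahedron S \<longleftrightarrow>
     3 simplex S \<and>
     (\<forall>F G. F facet_of S \<longrightarrow> G facet_of S \<longrightarrow> congruent_sets F G) \<and>
     (\<exists>k>0. \<forall>F. F facet_of S \<longrightarrow>
        (\<exists>a b c. F = convex hull {a, b, c} \<and>
                 dist a b = sqrt 3 * k \<and> dist a c = sqrt 3 * k \<and> dist b c = 2 * k))"

text \<open>The length of an edge, which is a closed segment, is its diameter.\<close>

definition longest_edges :: "('a::euclidean_space) set \<Rightarrow> 'a set set" where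
  "longest_edges S = {e. e edge_of S \<and> (\<forall>e'. e' edge_of S \<longrightarrow> diameter e' \<le> diameter e)}"

end

theory Submission
  imports Defs
begin

text \<open>
  Limits of the bowls. Write \<open>s = r\<^sup>2 + 1/r\<^sup>2\<close>. Every coordinate of a bowl point is \<open>s\<close> times a constant
  plus something independent of \<open>r\<close>, so dividing the homogeneous coordinates by \<open>s\<close> gives the limit
  \<open>(e\<^sup>-\<^sup>i\<^sup>\<theta> : \<plusminus>2 : e\<^sup>i\<^sup>\<theta> : 0)\<close>, the sign being that of the bowl. After multiplication by \<open>e\<^sup>-\<^sup>i\<^sup>\<theta>\<close> this is
  the point of the Moebius strip with angle \<open>-2\<theta>\<close> and \<open>x = \<plusminus>2\<close>. Reducing the angle modulo \<open>2\<pi>\<close> may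
  change the sign of \<open>x\<close>, so the rim of either bowl meets both \<open>x = 2\<close> and \<open>x = -2\<close>.

  The map \<open>\<phi>\<close>. It is computable only where preimages under \<open>\<phi>\<^sub>1\<close> are unique, so
  injectivity of \<open>\<phi>\<^sub>1\<close> is proved first (\<open>inj_on_phi1\<close>). A point determines the polynomial with roots
  \<open>e\<^sup>i\<^sup>\<alpha>, e\<^sup>i\<^sup>\<beta>, e\<^sup>i\<^sup>\<gamma>, e\<^sup>i\<^sup>\<delta>\<close>, where \<open>\<delta> = -(\<alpha>+\<beta>+\<gamma>)\<close>: the product of the roots is \<open>1\<close>, and the third
  symmetric function is the conjugate of the first. Hence it determines the multiset of exponentials.
  The inequalities defining \<open>R'\<close> say that \<open>\<delta> \<le> \<alpha> \<le> \<beta> \<le> \<gamma> \<le> \<delta> + 2\<pi>\<close>. Angles with sum \<open>0\<close> that lie in an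
  interval of length \<open>2\<pi>\<close> are determined by their exponentials (\<open>multiset_eq_of_image_cis_eq\<close>), and
  the order then identifies \<open>\<alpha>, \<beta>, \<gamma>\<close>. The upper line is \<open>\<phi>\<^sub>1(-t, t, t)\<close> for \<open>0 \<le> t \<le> \<pi>\<close> and the lower
  one \<open>\<phi>\<^sub>1(t, t, \<pi>-t)\<close> for \<open>\<bar>t\<bar> \<le> \<pi>/2\<close>; the linear map \<open>T\<close> sends these segments to \<open>OA\<^sub>2\<close> and \<open>A\<^sub>1A\<^sub>3\<close>.

  The tetrahedron. The four gaps between cyclically consecutive angles are nonnegative with sum \<open>2\<pi>\<close>;
  divided by \<open>2\<pi>\<close> they are the barycentric coordinates, which identifies \<open>R\<close> with the simplex
  \<open>OA\<^sub>1A\<^sub>2A\<^sub>3\<close> (\<open>R_set_eq_hull\<close>). Its edges \<open>OA\<^sub>2\<close> and \<open>A\<^sub>1A\<^sub>3\<close> have length \<open>2k\<close> and the other four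
  \<open>\<surd>3 k\<close>, where \<open>k = \<pi>/\<surd>2\<close>. In particular opposite edges are equal, so any two faces are exchanged by a
  half-turn (\<open>half_turn_about_bimedian\<close>) and are congruent.
\<close>

section \<open>Limits at infinity in projective space\<close>

lemma tendsto_abs_proj3:
  assumes lim: "(f \<longlongrightarrow> v) F" and "v \<noteq> 0"
  shows "((\<lambda>x. abs_proj3 (f x)) \<longlongrightarrow> abs_proj3 v) F"
proof (rule topological_tendstoI)
  fix U :: "proj3 set"
  assume "open U" "abs_proj3 v \<in> U"
  then have "open {w. w \<noteq> 0 \<and> abs_proj3 w \<in> U}" "v \<in> {w. w \<noteq> 0 \<and> abs_proj3 w \<in> U}"
    using \<open>v \<noteq> 0\<close> by (simp_all add: open_proj3_def)
  with lim have "eventually (\<lambda>x. f x \<in> {w. w \<noteq> 0 \<and> abs_proj3 w \<in> U}) F"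
    by (rule topological_tendstoD)
  then show "eventually (\<lambda>x. abs_proj3 (f x) \<in> U) F"
    by (rule eventually_mono) simp
qed

lemma tendsto_hom_point:
  assumes "(f1 \<longlongrightarrow> a) F" "(f2 \<longlongrightarrow> b) F" "(f3 \<longlongrightarrow> c) F" "(f4 \<longlongrightarrow> d) F"
    and nz: "(a, b, c, d) \<noteq> (0, 0, 0, 0)"
  shows "((\<lambda>x. hom_point (f1 x) (f2 x) (f3 x) (f4 x)) \<longlongrightarrow> hom_point a b c d) F"
  unfolding hom_point_def
proof (rule tendsto_abs_proj3)
  show "((\<lambda>x. vector [f1 x, f2 x, f3 x, f4 x] :: complex^4) \<longlongrightarrow> vector [a, b, c, d]) F"
  proof (rule vec_tendstoI)
    fix i :: 4
    show "((\<lambda>x. (vector [f1 x, f2 x, f3 x, f4 x] :: complex^4) $ i) \<longlongrightarrow> vector [a, b, c, d] $ i) F"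
      using assms(1-4) exhaust_4[of i] by (auto simp: vector_4)
  qed
  show "(vector [a, b, c, d] :: complex^4) \<noteq> 0"
    using nz by (auto simp: vec_eq_iff forall_4 vector_4)
qed

text \<open>Homogeneous coordinates may be divided by the scale \<open>s\<close>, which turns the last coordinate \<open>1\<close>
  into \<open>1/s\<close>.\<close>

lemma tendsto_embed_C3_at_infinity:
  assumes s: "filterlim s at_top F"
    and "((\<lambda>x. f x $ 1 / of_real (s x)) \<longlongrightarrow> a) F"
      "((\<lambda>x. f x $ 2 / of_real (s x)) \<longlongrightarrow> b) F"
      "((\<lambda>x. f x $ 3 / of_real (s x)) \<longlongrightarrow> c) F"
    and nz: "(a, b, c) \<noteq> (0, 0, 0)"
  shows "((\<lambda>x. embed_C3 (f x)) \<longlongrightarrow> hom_point a b c 0) F"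
proof -
  have s': "filterlim s at_infinity F"
    using s by (rule filterlim_at_top_imp_at_infinity)
  have inv: "((\<lambda>x. of_real (1 / s x) :: complex) \<longlongrightarrow> of_real 0) F"
    by (intro tendsto_of_real tendsto_divide_0[OF tendsto_const s'])
  have "((\<lambda>x. hom_point (f x $ 1 / of_real (s x)) (f x $ 2 / of_real (s x))
      (f x $ 3 / of_real (s x)) (of_real (1 / s x))) \<longlongrightarrow> hom_point a b c (of_real 0)) F"
    using assms nz by (intro tendsto_hom_point inv) auto
  moreover have "eventually (\<lambda>x. hom_point (f x $ 1 / of_real (s x)) (f x $ 2 / of_real (s x))
      (f x $ 3 / of_real (s x)) (of_real (1 / s x)) = embed_C3 (f x)) F"
  proof -
    have "eventually (\<lambda>x. s x > 0) F"
      using s by (simp add: filterlim_at_top_dense)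
    then show ?thesis
    proof (rule eventually_mono)
      fix x assume "s x > 0"
      then show "hom_point (f x $ 1 / of_real (s x)) (f x $ 2 / of_real (s x))
          (f x $ 3 / of_real (s x)) (of_real (1 / s x)) = embed_C3 (f x)"
        unfolding embed_C3_def
        by (subst hom_point_eq_iff) (auto intro!: exI[of _ "complex_of_real (s x)"])
    qed
  qed
  ultimately show ?thesis
    by (simp add: tendsto_cong)
qed

text \<open>Multiplying by \<open>e\<^sup>-\<^sup>i\<^sup>\<theta>\<close> gives the strip point with angle \<open>-2\<theta>\<close>. That angle has to be moved into
  \<open>[0, 2\<pi>)\<close>; each turn changes the sign of the half-angle factor, so \<open>x\<close> changes sign with it.\<close>

lemma hom_point_in_moebius_boundary:
  assumes "x = 2 \<or> x = -2"
  shows "hom_point (cis (-\<theta>)) (of_real x) (cis \<theta>) 0 \<in> moebius_boundary"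
proof -
  define t where "t = -2*\<theta> / (2*pi)"
  define \<psi> where "\<psi> = 2*pi * (t - of_int \<lfloor>t\<rfloor>)"
  have t: "2*pi * t = -2*\<theta>"
    by (simp add: t_def)
  have "\<psi> = -2*\<theta> + 2*pi * of_int (- \<lfloor>t\<rfloor>)"
    unfolding \<psi>_def t[symmetric] by (simp add: right_diff_distrib)
  then obtain k :: int where k: "\<psi> = -2*\<theta> + 2*pi * of_int k"
    by blast
  have "0 \<le> t - of_int \<lfloor>t\<rfloor>" "t - of_int \<lfloor>t\<rfloor> < 1"
    by linarith+
  then have range: "0 \<le> \<psi>" "\<psi> < 2*pi"
    using mult_nonneg_nonneg[of "2*pi" "t - of_int \<lfloor>t\<rfloor>"]
      mult_strict_left_mono[of "t - of_int \<lfloor>t\<rfloor>" 1 "2*pi"]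
    unfolding \<psi>_def by simp_all
  have half: "cis (pi * of_int k) = of_real (if even k then 1 else -1)"
    by (simp add: complex_eq_iff cos_npi_int sin_npi_int)
  define y where "y = x * (if even k then 1 else -1)"
  have \<psi>2: "\<psi>/2 = -\<theta> + pi * of_int k"
    by (simp add: k)
  have c2: "cis (\<psi>/2) = cis (-\<theta>) * of_real (if even k then 1 else -1)"
    unfolding half[symmetric] cis_mult \<psi>2 ..
  have c1: "cis \<psi> = cis (-\<theta>) * cis (-\<theta>)"
  proof -
    have "cis \<psi> = cis (\<psi>/2) * cis (\<psi>/2)"
      by (simp add: cis_mult)
    then show ?thesis by (simp add: c2)
  qed
  have "of_real y * cis (\<psi>/2) = of_real x * cis (-\<theta>)"
    by (simp add: c2 y_def)
  moreover have "cis \<theta> * cis (-\<theta>) = 1"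
    by (simp add: cis_mult)
  ultimately have "hom_point (cis (-\<theta>)) (of_real x) (cis \<theta>) 0 = moebius_point \<psi> y"
    unfolding moebius_point_def
    by (subst hom_point_eq_iff) (auto intro!: exI[of _ "cis (-\<theta>)"] simp: c1 mult.commute)
  moreover have "y = -2 \<or> y = 2"
    using assms by (auto simp: y_def)
  ultimately show ?thesis
    using range unfolding moebius_boundary_def by blast
qed

lemma filterlim_square_plus_inverse: "filterlim (\<lambda>r::real. r^2 + 1/r^2) at_top at_top"
proof (rule filterlim_at_top_mono[OF filterlim_pow_at_top[OF _ filterlim_ident, of 2]])
  show "eventually (\<lambda>r::real. r^2 \<le> r^2 + 1/r^2) at_top"
    by (rule always_eventually) simp
qed simp

lemma tendsto_ray_over_scale:
  assumes "filterlim s at_top F"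
  shows "((\<lambda>x. (of_real (s x) * a + b) / of_real (s x) :: complex) \<longlongrightarrow> a) F"
proof -
  have "((\<lambda>x. a + of_real (1 / s x) * b) \<longlongrightarrow> a + of_real 0 * b) F"
    by (intro tendsto_intros tendsto_divide_0[OF tendsto_const]
        filterlim_at_top_imp_at_infinity assms)
  moreover have "eventually (\<lambda>x. s x > 0) F"
    using assms by (simp add: filterlim_at_top_dense)
  then have "eventually (\<lambda>x. a + of_real (1 / s x) * b = (of_real (s x) * a + b) / of_real (s x)) F"
    by (rule eventually_mono) (simp add: field_simps)
  ultimately show ?thesis
    by (simp add: tendsto_cong)
qed

lemma bowls_tend_to_moebius_boundary:
  "\<exists>p\<in>moebius_boundary. ((\<lambda>r. embed_C3 (top_bowl r \<theta>)) \<longlongrightarrow> p) at_top"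
  "\<exists>p\<in>moebius_boundary. ((\<lambda>r. embed_C3 (lower_bowl r \<theta>)) \<longlongrightarrow> p) at_top"
proof -
  let ?s = "\<lambda>r::real. r^2 + 1/r^2"
  note lim = tendsto_ray_over_scale[OF filterlim_square_plus_inverse]
  have top: "top_bowl r \<theta> = vector [of_real (?s r) * cis (-\<theta>) + 2 * cis \<theta>,
      of_real (?s r) * of_real 2 + of_real (2 * cos (2*\<theta>)),
      of_real (?s r) * cis \<theta> + 2 * cis (-\<theta>)]" for r
    unfolding top_bowl_def of_real_add of_real_mult by (simp add: mult.commute)
  have low: "lower_bowl r \<theta> = vector [of_real (?s r) * cis (-\<theta>) + (- 2 * cis \<theta>),
      of_real (?s r) * of_real (-2) + of_real (2 * cos (2*\<theta>)),
      of_real (?s r) * cis \<theta> + (- 2 * cis (-\<theta>))]" for r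
    unfolding lower_bowl_def of_real_add of_real_mult by (simp add: mult.commute)
  have "((\<lambda>r. embed_C3 (top_bowl r \<theta>)) \<longlongrightarrow> hom_point (cis (-\<theta>)) (of_real 2) (cis \<theta>) 0) at_top"
    unfolding top
    by (rule tendsto_embed_C3_at_infinity[OF filterlim_square_plus_inverse])
      (unfold vector_3, (rule lim)+, simp)
  then show "\<exists>p\<in>moebius_boundary. ((\<lambda>r. embed_C3 (top_bowl r \<theta>)) \<longlongrightarrow> p) at_top"
    using hom_point_in_moebius_boundary by blast
  have "((\<lambda>r. embed_C3 (lower_bowl r \<theta>)) \<longlongrightarrow> hom_point (cis (-\<theta>)) (of_real (-2)) (cis \<theta>) 0) at_top"
    unfolding low
    by (rule tendsto_embed_C3_at_infinity[OF filterlim_square_plus_inverse])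
      (unfold vector_3, (rule lim)+, simp)
  then show "\<exists>p\<in>moebius_boundary. ((\<lambda>r. embed_C3 (lower_bowl r \<theta>)) \<longlongrightarrow> p) at_top"
    using hom_point_in_moebius_boundary by blast
qed


section \<open>Angles are determined by the symmetric functions of their exponentials\<close>

lemma all_0_of_sum_mset_eq_0:
  fixes f :: "'a \<Rightarrow> int"
  assumes "\<And>z. z \<in># C \<Longrightarrow> 0 \<le> f z" "(\<Sum>z\<in>#C. f z) = 0"
  shows "\<forall>z\<in>#C. f z = 0"
proof -
  have "0 \<le> (\<Sum>z\<in>#C. f z) \<and> ((\<Sum>z\<in>#C. f z) = 0 \<longrightarrow> (\<forall>z\<in>#C. f z = 0))"
    using assms(1)
  proof (induction C)
    case (add c C)
    then have "0 \<le> f c" "0 \<le> (\<Sum>z\<in>#C. f z) \<and> ((\<Sum>z\<in>#C. f z) = 0 \<longrightarrow> (\<forall>z\<in>#C. f z = 0))"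
      by simp_all
    then show ?case by (auto simp: add_nonneg_eq_0_iff)
  qed simp
  with assms(2) show ?thesis by blast
qed

text \<open>Match the angles of \<open>A\<close> and \<open>B\<close> that have equal exponentials. Matched angles differ by \<open>2\<pi>k\<close>
  with integers \<open>k\<close> of sum \<open>0\<close>. If some \<open>k\<close> is nonzero then both signs occur, and the two bounds on
  differences leave no slack: all nonzero \<open>k\<close> are \<open>\<plusminus>1\<close>, those with \<open>k = 1\<close> move the least angle \<open>m\<close> to
  the greatest angle \<open>M = m + 2\<pi>\<close>, and those with \<open>k = -1\<close> move \<open>M\<close> to \<open>m\<close>. Equally many moves of
  both kinds leave the multiset unchanged.\<close>

lemma multiset_eq_of_image_cis_eq:
  fixes A B :: "real multiset"
  assumes img: "image_mset cis A = image_mset cis B"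
    and sum: "sum_mset A = sum_mset B"
    and A: "\<And>x y. x \<in># A \<Longrightarrow> y \<in># A \<Longrightarrow> x - y \<le> 2*pi"
    and B: "\<And>x y. x \<in># B \<Longrightarrow> y \<in># B \<Longrightarrow> x - y \<le> 2*pi"
  shows "A = B"
proof -
  have "rel_mset (\<lambda>x y. cis x = cis y) A B"
    using img unfolding multiset.rel_eq[symmetric] multiset.rel_map .
  then obtain C where "set_mset C \<subseteq> {(x, y). cis x = cis y}"
    and AC: "A = image_mset fst C" and BC: "B = image_mset snd C"
    unfolding multiset.in_rel by blast
  then have C: "cis (fst z) = cis (snd z)" if "z \<in># C" for z
    using that by auto
  define k :: "real \<times> real \<Rightarrow> int" where "k z = \<lfloor>(snd z - fst z) / (2*pi)\<rfloor>" for z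
  have k: "snd z = fst z + 2*pi * of_int (k z)" if "z \<in># C" for z
  proof -
    have "cos (snd z) = cos (fst z)" "sin (snd z) = sin (fst z)"
      using C[OF that] by (auto simp: complex_eq_iff)
    then obtain n :: int where "snd z = fst z + 2*pi * of_int n"
      using sin_cos_eq_iff[of "snd z" "fst z"] by auto
    then show ?thesis by (simp add: k_def)
  qed
  have "(\<Sum>z\<in>#C. snd z) = (\<Sum>z\<in>#C. fst z + 2*pi * of_int (k z))"
    using k by (intro arg_cong[of _ _ sum_mset] image_mset_cong)
  then have "(\<Sum>z\<in>#C. 2*pi * of_int (k z)) = 0"
    using sum by (simp add: AC BC sum_mset.distrib)
  moreover have "(\<Sum>z\<in>#C. 2*pi * of_int (k z)) = 2*pi * of_int (\<Sum>z\<in>#C. k z)"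
    by (induction C) (simp_all add: algebra_simps)
  ultimately have k0: "(\<Sum>z\<in>#C. k z) = 0"
    by simp
  have opposite: "k p = 1 \<and> k q = -1 \<and> snd p = fst q \<and> snd q = fst p"
    if "p \<in># C" "q \<in># C" "k p > 0" "k q < 0" for p q
  proof -
    have le: "fst q - fst p \<le> 2*pi" "snd p - snd q \<le> 2*pi"
      using that(1,2) A[of "fst q" "fst p"] B[of "snd p" "snd q"] by (simp_all add: AC BC)
    have "2*pi * of_int (k p - k q) \<le> 2*pi * 2"
      using le k[OF that(1)] k[OF that(2)] by (simp add: algebra_simps)
    then have "real_of_int (k p - k q) \<le> 2"
      by (subst (asm) mult_le_cancel_left_pos) simp_all
    with that(3,4) have "k p = 1" "k q = -1"
      by linarith+
    with le k[OF that(1)] k[OF that(2)] show ?thesis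
      by simp
  qed
  have "\<exists>m M. \<forall>z\<in>#C. k z \<noteq> 0 \<longrightarrow> (k z = 1 \<and> fst z = m \<and> snd z = M) \<or> (k z = -1 \<and> fst z = M \<and> snd z = m)"
  proof (cases "\<exists>z\<in>#C. k z \<noteq> 0")
    case True
    have "\<exists>p\<in>#C. k p > 0" "\<exists>q\<in>#C. k q < 0"
    proof -
      show "\<exists>p\<in>#C. k p > 0"
      proof (rule ccontr)
        assume "\<not> ?thesis"
        then have "\<forall>z\<in>#C. - k z = 0"
          using sum_mset_distrib_left[of "-1" k C] k0
          by (intro all_0_of_sum_mset_eq_0) (auto simp: not_less)
        with True show False by simp
      qed
      show "\<exists>q\<in>#C. k q < 0"
      proof (rule ccontr)
        assume "\<not> ?thesis"
        then have "\<forall>z\<in>#C. k z = 0"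
          using k0 by (intro all_0_of_sum_mset_eq_0) (auto simp: not_less)
        with True show False by simp
      qed
    qed
    then obtain p q where pq: "p \<in># C" "q \<in># C" "k p > 0" "k q < 0"
      by blast
    have "(k z = 1 \<and> fst z = fst p \<and> snd z = fst q) \<or> (k z = -1 \<and> fst z = fst q \<and> snd z = fst p)"
      if "z \<in># C" "k z \<noteq> 0" for z
      using opposite[of z q] opposite[of p z] opposite[of p q] that pq by (cases "k z > 0") auto
    then show ?thesis by blast
  qed blast
  then obtain m M where mM: "k z = 0 \<or> (k z = 1 \<and> fst z = m \<and> snd z = M) \<or> (k z = -1 \<and> fst z = M \<and> snd z = m)"
    if "z \<in># C" for z by metis
  \<comment> \<open>Any function changes by \<open>k (f M - f m)\<close> along a matched pair, hence has the same sum over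
    \<open>A\<close> and over \<open>B\<close>. The indicator of a point gives the multiplicities.\<close>
  show "A = B"
  proof (rule multiset_eqI)
    fix a
    let ?f = "\<lambda>x::real. if x = a then 1 else 0 :: int"
    have "?f (snd z) = ?f (fst z) + k z * (?f M - ?f m)" if "z \<in># C" for z
      using mM[OF that] k[OF that] by auto
    then have "(\<Sum>z\<in>#C. ?f (snd z)) = (\<Sum>z\<in>#C. ?f (fst z) + k z * (?f M - ?f m))"
      by (intro arg_cong[of _ _ sum_mset] image_mset_cong)
    also have "\<dots> = (\<Sum>z\<in>#C. ?f (fst z))"
      by (simp only: k0 mult_zero_left add_0_right sum_mset.distrib sum_mset_distrib_right[symmetric])
    finally have "(\<Sum>x\<in>#B. ?f x) = (\<Sum>x\<in>#A. ?f x)"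
      by (simp add: AC BC image_mset.compositionality o_def)
    then show "count A a = count B a"
      by (simp add: sum_mset_delta)
  qed
qed

lemma proots_prod_linear:
  "proots (\<Prod>t\<in>#A. [:-t, 1:]) = (A :: 'a::idom multiset)"
  by (induction A) (simp_all add: proots_mult image_iff del: mult_pCons_left)

text \<open>The symmetric functions are, up to sign, the coefficients of the monic quartic with the given
  roots.\<close>

lemma multiset4_eq_of_symmetric_functions_eq:
  fixes a b c d :: "'a::idom"
  assumes "a + b + c + d = a' + b' + c' + d'"
    "a*b + a*c + a*d + b*c + b*d + c*d = a'*b' + a'*c' + a'*d' + b'*c' + b'*d' + c'*d'"
    "a*b*c + a*b*d + a*c*d + b*c*d = a'*b'*c' + a'*b'*d' + a'*c'*d' + b'*c'*d'"
    "a*b*c*d = a'*b'*c'*d'"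
  shows "{#a, b, c, d#} = {#a', b', c', d'#}"
proof -
  have expand: "(\<Prod>t\<in>#{#w, x, y, z#}. [:-t, 1:]) =
      [: w*x*y*z, -(w*x*y + w*x*z + w*y*z + x*y*z), w*x + w*y + w*z + x*y + x*z + y*z,
         -(w + x + y + z), 1 :]" for w x y z :: 'a
    by (simp add: algebra_simps)
  show ?thesis
    using assms by (subst (1 2) proots_prod_linear[symmetric]) (simp only: expand)
qed

lemma inj_on_phi1: "inj_on phi1 R'_set"
proof (rule inj_onI)
  fix p p' assume R: "p \<in> R'_set" "p' \<in> R'_set" and eq: "phi1 p = phi1 p'"
  \<comment> \<open>The angles of a point of \<open>R'\<close> in increasing order.\<close>
  define t where "t q = [- (q$1 + q$2 + q$3), q$1, q$2, q$3]" for q :: "real^3"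
  let ?E1 = "\<lambda>q::real^3. cis (q$1) + cis (q$2) + cis (q$3) + cis (- (q$1 + q$2 + q$3))"
  \<comment> \<open>The product of all four being \<open>1\<close>, the product of any three is the conjugate of the fourth.\<close>
  have e3: "cis (q$1) * cis (q$2) * cis (q$3) + cis (q$1) * cis (q$2) * cis (- (q$1 + q$2 + q$3))
      + cis (q$1) * cis (q$3) * cis (- (q$1 + q$2 + q$3))
      + cis (q$2) * cis (q$3) * cis (- (q$1 + q$2 + q$3)) = cnj (?E1 q)" for q :: "real^3"
    by (simp add: cis_mult cis_cnj algebra_simps)
  have e4: "cis (q$1) * cis (q$2) * cis (q$3) * cis (- (q$1 + q$2 + q$3)) = 1" for q :: "real^3"
    by (simp add: cis_mult)
  have e1: "?E1 p = ?E1 p'"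
    using arg_cong[OF eq, of "\<lambda>v. v$1"] unfolding phi1_def Let_def vector_3 .
  have e2: "cis (p$1) * cis (p$2) + cis (p$1) * cis (p$3) + cis (p$1) * cis (- (p$1 + p$2 + p$3))
      + cis (p$2) * cis (p$3) + cis (p$2) * cis (- (p$1 + p$2 + p$3))
      + cis (p$3) * cis (- (p$1 + p$2 + p$3)) =
      cis (p'$1) * cis (p'$2) + cis (p'$1) * cis (p'$3) + cis (p'$1) * cis (- (p'$1 + p'$2 + p'$3))
      + cis (p'$2) * cis (p'$3) + cis (p'$2) * cis (- (p'$1 + p'$2 + p'$3))
      + cis (p'$3) * cis (- (p'$1 + p'$2 + p'$3))"
    using arg_cong[OF eq, of "\<lambda>v. v$2"] unfolding phi1_def Let_def vector_3 .
  have "{#cis (p$1), cis (p$2), cis (p$3), cis (- (p$1 + p$2 + p$3))#} =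
      {#cis (p'$1), cis (p'$2), cis (p'$3), cis (- (p'$1 + p'$2 + p'$3))#}"
    by (rule multiset4_eq_of_symmetric_functions_eq[OF e1 e2]) (simp_all only: e1 e3 e4)
  then have img: "image_mset cis (mset (t p)) = image_mset cis (mset (t p'))"
    by (simp add: t_def add_mset_commute)
  have sorted: "sorted (t q)" if "q \<in> R'_set" for q
    using that by (simp add: t_def R'_set_def Let_def)
  have spread: "x - y \<le> 2*pi" if "q \<in> R'_set" "x \<in># mset (t q)" "y \<in># mset (t q)" for q x y
    using that by (auto simp: t_def R'_set_def Let_def)
  have "mset (t p) = mset (t p')"
    using img
  proof (rule multiset_eq_of_image_cis_eq)
    show "sum_mset (mset (t p)) = sum_mset (mset (t p'))"
      by (simp add: t_def)
  qed (rule spread[OF R(1)] spread[OF R(2)]; assumption)+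
  then have "t p = t p'"
    using sorted[OF R(1)] sorted[OF R(2)] by (metis properties_for_sort)
  then show "p = p'"
    by (simp add: t_def vec_eq_iff forall_3)
qed

lemma phi_phi1: "p \<in> R'_set \<Longrightarrow> phi (phi1 p) = T_map p"
  by (simp add: phi_def inv_into_f_f[OF inj_on_phi1])


section \<open>Tetrahedra whose opposite edges are equal\<close>

text \<open>In a tetrahedron \<open>PQRS\<close> with \<open>PR = QS\<close> and \<open>PS = QR\<close>, the line joining the midpoints of \<open>PQ\<close>
  and \<open>RS\<close> is perpendicular to both of these edges. The half-turn about it therefore reverses both.\<close>

lemma half_turn_about_bimedian:
  fixes P Q R S :: "'a::euclidean_space"
  assumes "dist P R = dist Q S" "dist P S = dist Q R"
  obtains h where "\<And>x y. dist (h x) (h y) = dist x y"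
    "\<And>X. h ` (convex hull X) = convex hull (h ` X)"
    "h P = Q" "h R = S" "h S = R"
proof -
  define m where "m = (1/2) *\<^sub>R (P + Q)"
  define n where "n = (1/2) *\<^sub>R (R + S)"
  define u where "u = n - m"
  \<comment> \<open>The linear part of the half-turn. For \<open>u = 0\<close> division by zero makes it \<open>x \<mapsto> -x\<close>, the point
    reflection, which serves equally well when the midpoints coincide.\<close>
  define L where "L x = (2 * (x \<bullet> u) / (u \<bullet> u)) *\<^sub>R u - x" for x
  define h where "h x = (m - L m) + L x" for x
  have linL: "linear L"
    by (rule linearI) (simp_all add: L_def algebra_simps add_divide_distrib)
  have norm: "norm (L x) = norm x" for x
  proof (cases "u = 0")
    case False
    then have "L x \<bullet> L x = x \<bullet> x"
      by (simp add: L_def inner_diff_left inner_diff_right inner_commute field_simps)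
    then show ?thesis by (simp add: norm_eq)
  qed (simp add: L_def)
  have perp: "L x = - x" if "x \<bullet> u = 0" for x
    using that by (simp add: L_def)
  have Lu: "L u = u"
    by (cases "u = 0") (simp_all add: L_def scaleR_2)
  have d: "(P - R) \<bullet> (P - R) = (Q - S) \<bullet> (Q - S)" "(P - S) \<bullet> (P - S) = (Q - R) \<bullet> (Q - R)"
    using assms by (simp_all add: dist_norm norm_eq)
  define a where "a = (1/2) *\<^sub>R (P - Q)"
  define b where "b = (1/2) *\<^sub>R (R - S)"
  have "a \<bullet> u = 0" "b \<bullet> u = 0"
    using d by (simp_all add: a_def b_def u_def m_def n_def inner_diff_left inner_diff_right inner_add_left
        inner_add_right inner_commute field_simps)
  have hm: "h (m + x) = m + L x" for x
    by (simp add: h_def linear_add[OF linL])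
  have eq: "P = m + a" "Q = m - a" "R = m + (u + b)" "S = m + (u - b)"
    by (simp_all add: m_def a_def u_def n_def b_def algebra_simps flip: scaleR_add_left)
  note L = linear_add[OF linL] linear_diff[OF linL] Lu perp[OF \<open>a \<bullet> u = 0\<close>] perp[OF \<open>b \<bullet> u = 0\<close>]
  have "h P = Q" "h R = S" "h S = R"
    unfolding eq hm by (simp_all add: L)
  moreover have "dist (h x) (h y) = dist x y" for x y
    by (simp add: h_def dist_norm norm linear_diff[OF linL, symmetric])
  moreover have "h ` (convex hull X) = convex hull (h ` X)" for X
  proof -
    have h: "h ` Y = (+) (m - L m) ` L ` Y" for Y
      by (auto simp: h_def)
    show ?thesis
      unfolding h convex_hull_translation convex_hull_linear_image[OF linL] ..
  qed
  ultimately show thesis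
    using that by blast
qed

lemma congruent_facets_if_opposite_edges_eq:
  fixes P Q R S :: "'a::euclidean_space"
  assumes "dist P R = dist Q S" "dist P S = dist Q R"
  shows "congruent_sets (convex hull {P, R, S}) (convex hull {Q, R, S})"
proof -
  obtain h where "\<And>x y. dist (h x) (h y) = dist x y"
    "\<And>X. h ` (convex hull X) = convex hull (h ` X)"
    "h P = Q" "h R = S" "h S = R"
    by (rule half_turn_about_bimedian[OF assms]) blast
  then show ?thesis
    unfolding congruent_sets_def by (intro exI[of _ h]) (simp add: insert_commute)
qed

lemma diameter_closed_segment: "diameter (closed_segment a b) = dist a (b :: 'a::euclidean_space)"
proof (rule antisym)
  show "diameter (closed_segment a b) \<le> dist a b"
  proof (rule diameter_le)
    fix x y assume "x \<in> closed_segment a b" "y \<in> closed_segment a b"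
    then show "norm (x - y) \<le> dist a b"
      using segment_furthest_le[of y a b x] dist_in_closed_segment[of x a b]
      by (auto simp: dist_norm)
  qed simp
  show "dist a b \<le> diameter (closed_segment a b)"
    by (rule diameter_bounded_bound) (simp_all add: bounded_closed_segment)
qed

lemma edge_of_simplex_iff:
  fixes C :: "'a::euclidean_space set"
  assumes "\<not> affine_dependent C"
  shows "e edge_of convex hull C \<longleftrightarrow> (\<exists>a\<in>C. \<exists>b\<in>C. a \<noteq> b \<and> e = closed_segment a b)"
proof -
  have "aff_dim (convex hull c) = 1 \<longleftrightarrow> card c = 2" if "c \<subseteq> C" for c
    using aff_dim_affine_independent[OF affine_independent_subset[OF assms that]]
    by (simp only: aff_dim_convex_hull) linarith
  then have "e edge_of convex hull C \<longleftrightarrow> (\<exists>c\<subseteq>C. card c = 2 \<and> e = convex hull c)"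
    unfolding edge_of_def face_of_convex_hull_affine_independent[OF assms] by auto
  also have "\<dots> \<longleftrightarrow> (\<exists>a\<in>C. \<exists>b\<in>C. a \<noteq> b \<and> e = closed_segment a b)"
    unfolding card_2_iff segment_convex_hull by (metis insert_subset empty_subsetI)
  finally show ?thesis .
qed


section \<open>The tetrahedron \<open>R\<close>\<close>

definition A1 :: "real^3" where "A1 = vector [0, - pi / sqrt 2, pi]"
definition A2 :: "real^3" where "A2 = vector [pi, 0, pi]"
definition A3 :: "real^3" where "A3 = vector [0, pi / sqrt 2, pi]"

lemma A_nth [simp]:
  "A1$1 = 0" "A1$2 = - pi / sqrt 2" "A1$3 = pi"
  "A2$1 = pi" "A2$2 = 0" "A2$3 = pi"
  "A3$1 = 0" "A3$2 = pi / sqrt 2" "A3$3 = pi"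
  by (simp_all add: A1_def A2_def A3_def)

lemma A_distinct: "0 \<noteq> A1" "0 \<noteq> A2" "0 \<noteq> A3" "A1 \<noteq> A2" "A1 \<noteq> A3" "A2 \<noteq> A3"
  by (auto simp: vec_eq_iff forall_3)

lemma dist_real3: "dist x y = sqrt ((x$1 - y$1)^2 + (x$2 - y$2)^2 + (x$3 - y$3)^2)"
  for x y :: "real^3"
  by (simp add: dist_vec_def L2_set_def sum_3 dist_real_def)

lemma A_dist:
  "dist 0 A2 = 2 * (pi / sqrt 2)" "dist A1 A3 = 2 * (pi / sqrt 2)"
  "dist 0 A1 = sqrt 3 * (pi / sqrt 2)" "dist 0 A3 = sqrt 3 * (pi / sqrt 2)"
  "dist A1 A2 = sqrt 3 * (pi / sqrt 2)" "dist A2 A3 = sqrt 3 * (pi / sqrt 2)"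
  unfolding dist_real3
  by (intro real_sqrt_unique; simp add: field_simps power2_eq_square)+

lemmas A_dist_both = A_dist A_dist[THEN trans[OF dist_commute]]

lemma independent_A: "independent {A1, A2, A3}"
  unfolding independent_explicit
  using A_distinct by (auto simp: vec_eq_iff forall_3)

lemma affine_independent_OA: "\<not> affine_dependent {0, A1, A2, A3}"
  using affine_dependent_iff_dependent[of 0 "{A1, A2, A3}"] independent_A A_distinct by simp

text \<open>For \<open>p = (\<alpha>, \<beta>, \<gamma>)\<close> and \<open>\<delta> = -(\<alpha>+\<beta>+\<gamma>)\<close>, the barycentric coordinates of \<open>T p\<close> with respect to
  \<open>A\<^sub>1, A\<^sub>2, A\<^sub>3, O\<close> are the gaps \<open>\<alpha>-\<delta>, \<beta>-\<alpha>, \<gamma>-\<beta>, \<delta>+2\<pi>-\<gamma>\<close> divided by \<open>2\<pi>\<close>. So the four inequalities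
  defining \<open>R'\<close> are exactly their nonnegativity.\<close>

lemma R_set_eq_hull: "R_set = convex hull {0, A1, A2, A3}"
proof -
  have hull: "convex hull {0, A1, A2, A3} =
      {a *\<^sub>R A1 + b *\<^sub>R A2 + c *\<^sub>R A3 | a b c. 0 \<le> a \<and> 0 \<le> b \<and> 0 \<le> c \<and> a + b + c \<le> 1}"
    (is "_ = ?H")
  proof -
    have "y \<in> ?H \<longleftrightarrow> (\<exists>u. (\<forall>x\<in>{A1, A2, A3}. 0 \<le> u x) \<and> sum u {A1, A2, A3} \<le> 1 \<and>
        (\<Sum>x\<in>{A1, A2, A3}. u x *\<^sub>R x) = y)" (is "_ \<longleftrightarrow> ?P") for y
    proof
      assume "y \<in> ?H"
      then obtain a b c where "0 \<le> a" "0 \<le> b" "0 \<le> c" "a + b + c \<le> 1"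
        "y = a *\<^sub>R A1 + b *\<^sub>R A2 + c *\<^sub>R A3" by blast
      then show ?P
        using A_distinct
        by (intro exI[of _ "\<lambda>x. if x = A1 then a else if x = A2 then b else c"]) auto
    next
      assume ?P
      then show "y \<in> ?H"
        using A_distinct by (fastforce simp: add.assoc)
    qed
    then show ?thesis
      using A_distinct by (subst Starlike.simplex) auto
  qed
  show ?thesis
    unfolding hull
  proof
    show "R_set \<subseteq> ?H"
    proof
      fix q assume "q \<in> R_set"
      then obtain p where p: "p \<in> R'_set" "q = T_map p"
        by (auto simp: R_set_def)
      define a where "a = (2 * p$1 + p$2 + p$3) / (2*pi)"
      define b where "b = (p$2 - p$1) / (2*pi)"
      define c where "c = (p$3 - p$2) / (2*pi)"
      have "a + b + c = (p$1 + p$2 + 2 * p$3) / (2*pi)"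
        unfolding a_def b_def c_def add_divide_distrib[symmetric] by simp
      then have "0 \<le> a" "0 \<le> b" "0 \<le> c" "a + b + c \<le> 1"
        using p(1) by (simp_all add: R'_set_def Let_def a_def b_def c_def)
      moreover have "q = a *\<^sub>R A1 + b *\<^sub>R A2 + c *\<^sub>R A3"
        unfolding p(2) by (simp add: T_map_def Let_def vec_eq_iff forall_3 a_def b_def c_def field_simps)
      ultimately show "q \<in> ?H" by blast
    qed
    show "?H \<subseteq> R_set"
    proof
      fix q assume "q \<in> ?H"
      then obtain a b c where abc: "0 \<le> a" "0 \<le> b" "0 \<le> c" "a + b + c \<le> 1"
        and q: "q = a *\<^sub>R A1 + b *\<^sub>R A2 + c *\<^sub>R A3"
        by blast
      \<comment> \<open>The combination with the same coefficients of the preimages of \<open>A\<^sub>1, A\<^sub>2, A\<^sub>3\<close>, which are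
        \<open>(\<pi>/2, \<pi>/2, \<pi>/2)\<close>, \<open>(-\<pi>, \<pi>, \<pi>)\<close> and \<open>(-\<pi>/2, -\<pi>/2, 3\<pi>/2)\<close>.\<close>
      define p :: "real^3" where
        "p = pi *\<^sub>R vector [a/2 - b - c/2, a/2 + b - c/2, a/2 + b + 3*c/2]"
      have "pi * (a + b + c) \<le> pi"
        using abc(4) by simp
      then have "p \<in> R'_set"
        using abc(1-3) by (simp add: R'_set_def Let_def p_def algebra_simps)
      moreover have "q = T_map p"
        unfolding q by (simp add: T_map_def Let_def vec_eq_iff forall_3 p_def field_simps)
      ultimately show "q \<in> R_set"
        by (simp add: R_set_def)
    qed
  qed
qed

text \<open>The half-turns exchange any two vertices and the other two, so they carry each face to each
  other face; the scale is \<open>k = \<pi>/\<surd>2\<close>.\<close>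

lemma sqrt3_sqrt3_2_tetrahedron_R_set: "sqrt3_sqrt3_2_tetrahedron R_set"
proof -
  let ?C = "{0, A1, A2, A3}"
  have facets: "F facet_of R_set \<longleftrightarrow> F \<in> (\<lambda>v. convex hull (?C - {v})) ` ?C" for F
    unfolding R_set_eq_hull facet_of_convex_hull_affine_independent_alt[OF affine_independent_OA]
    using A_distinct by auto
  have faces: "?C - {0} = {A1, A2, A3}" "?C - {A1} = {0, A2, A3}" "?C - {A2} = {0, A1, A3}"
    "?C - {A3} = {0, A1, A2}"
    using A_distinct by auto
  show ?thesis
    unfolding sqrt3_sqrt3_2_tetrahedron_def
  proof (intro conjI allI impI)
    show "3 simplex R_set"
      unfolding R_set_eq_hull using affine_independent_OA A_distinct
      by (intro simplex_convex_hull) simp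
  next
    have refl: "congruent_sets F F" for F :: "(real^3) set"
      unfolding congruent_sets_def by (intro exI[of _ id]) simp
    have cong: "congruent_sets (convex hull {P, R, S}) (convex hull {Q, R, S}) \<and>
        congruent_sets (convex hull {Q, R, S}) (convex hull {P, R, S})"
      if "dist P R = dist Q S" "dist P S = dist Q R" for P Q R S :: "real^3"
      using that by (auto intro: congruent_facets_if_opposite_edges_eq)
    let ?F = "\<lambda>P Q R. convex hull {P, Q, R :: real^3}"
    have "congruent_sets (?F 0 A2 A3) (?F A1 A2 A3) \<and> congruent_sets (?F A1 A2 A3) (?F 0 A2 A3)"
      by (rule cong) (simp_all only: A_dist_both)
    moreover have "congruent_sets (?F 0 A1 A3) (?F A2 A1 A3) \<and> congruent_sets (?F A2 A1 A3) (?F 0 A1 A3)"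
      by (rule cong) (simp_all only: A_dist_both)
    moreover have "congruent_sets (?F 0 A1 A2) (?F A3 A1 A2) \<and> congruent_sets (?F A3 A1 A2) (?F 0 A1 A2)"
      by (rule cong) (simp_all only: A_dist_both)
    moreover have "congruent_sets (?F A1 0 A3) (?F A2 0 A3) \<and> congruent_sets (?F A2 0 A3) (?F A1 0 A3)"
      by (rule cong) (simp_all only: A_dist_both)
    moreover have "congruent_sets (?F A1 0 A2) (?F A3 0 A2) \<and> congruent_sets (?F A3 0 A2) (?F A1 0 A2)"
      by (rule cong) (simp_all only: A_dist_both)
    moreover have "congruent_sets (?F A2 0 A1) (?F A3 0 A1) \<and> congruent_sets (?F A3 0 A1) (?F A2 0 A1)"
      by (rule cong) (simp_all only: A_dist_both)
    moreover have "?F A2 A1 A3 = ?F A1 A2 A3" "?F A3 A1 A2 = ?F A1 A2 A3" "?F A1 0 A3 = ?F 0 A1 A3"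
      "?F A2 0 A3 = ?F 0 A2 A3" "?F A1 0 A2 = ?F 0 A1 A2" "?F A3 0 A2 = ?F 0 A2 A3"
      "?F A2 0 A1 = ?F 0 A1 A2" "?F A3 0 A1 = ?F 0 A1 A3"
      by (simp_all add: insert_commute)
    moreover note refl
    moreover
    fix F G assume "F facet_of R_set" "G facet_of R_set"
    then have "F \<in> {?F A1 A2 A3, ?F 0 A2 A3, ?F 0 A1 A3, ?F 0 A1 A2}"
      "G \<in> {?F A1 A2 A3, ?F 0 A2 A3, ?F 0 A1 A3, ?F 0 A1 A2}"
      by (simp_all only: facets image_insert image_empty faces)
    ultimately show "congruent_sets F G"
      by (elim insertE emptyE; simp only:)
  next
    have "\<exists>a b c. F = convex hull {a, b, c} \<and> dist a b = sqrt 3 * (pi / sqrt 2) \<and>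
        dist a c = sqrt 3 * (pi / sqrt 2) \<and> dist b c = 2 * (pi / sqrt 2)"
      if "F facet_of R_set" for F
    proof -
      have "F \<in> {convex hull {A2, A1, A3}, convex hull {A3, 0, A2}, convex hull {0, A1, A3},
          convex hull {A1, 0, A2}}"
        using that unfolding facets image_insert image_empty faces by (auto simp: insert_commute)
      then show ?thesis
        using A_dist_both by blast
    qed
    then show "\<exists>k>0. \<forall>F. F facet_of R_set \<longrightarrow> (\<exists>a b c. F = convex hull {a, b, c} \<and>
        dist a b = sqrt 3 * k \<and> dist a c = sqrt 3 * k \<and> dist b c = 2 * k)"
      by (intro exI[of _ "pi / sqrt 2"]) simp
  qed
qed

lemma longest_edges_R_set: "longest_edges R_set = {closed_segment 0 A2, closed_segment A1 A3}"
proof -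
  have edges: "e edge_of R_set \<longleftrightarrow>
      e \<in> {closed_segment 0 A2, closed_segment A1 A3, closed_segment 0 A1, closed_segment 0 A3,
           closed_segment A1 A2, closed_segment A2 A3}" for e
    unfolding R_set_eq_hull edge_of_simplex_iff[OF affine_independent_OA]
    using A_distinct by (auto simp: closed_segment_commute)
  have "sqrt 3 < 2"
    by (rule real_less_lsqrt) simp_all
  define s l where "s = sqrt 3 * (pi / sqrt 2)" and "l = 2 * (pi / sqrt 2)"
  have "s < l"
    unfolding s_def l_def using \<open>sqrt 3 < 2\<close> by (intro mult_strict_right_mono) simp_all
  have diam: "diameter (closed_segment 0 A2) = l" "diameter (closed_segment A1 A3) = l"
    "diameter (closed_segment 0 A1) = s" "diameter (closed_segment 0 A3) = s"
    "diameter (closed_segment A1 A2) = s" "diameter (closed_segment A2 A3) = s"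
    unfolding diameter_closed_segment s_def l_def by (rule A_dist)+
  have le: "diameter e \<le> l" if "e edge_of R_set" for e
    using that \<open>s < l\<close> unfolding edges by (elim insertE emptyE) (simp_all add: diam)
  have "closed_segment 0 A2 edge_of R_set"
    unfolding edges by simp
  then have "e \<in> longest_edges R_set \<longleftrightarrow> e edge_of R_set \<and> diameter e = l" for e
    unfolding longest_edges_def using le diam(1) by (auto intro: antisym)
  moreover have "e edge_of R_set \<and> diameter e = l \<longleftrightarrow> e \<in> {closed_segment 0 A2, closed_segment A1 A3}" for e
  proof
    assume "e edge_of R_set \<and> diameter e = l"
    then show "e \<in> {closed_segment 0 A2, closed_segment A1 A3}"
      using \<open>s < l\<close> unfolding edges by (elim conjE insertE emptyE) (simp_all add: diam)
  next
    assume "e \<in> {closed_segment 0 A2, closed_segment A1 A3}"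
    then show "e edge_of R_set \<and> diameter e = l"
      unfolding edges by (elim insertE emptyE) (simp_all add: diam)
  qed
  ultimately show ?thesis
    by blast
qed


section \<open>The images of the self-intersection lines\<close>

text \<open>The preimages under \<open>\<phi>\<^sub>1\<close> consist of two pairs of equal exponentials: \<open>e\<^sup>i\<^sup>t, e\<^sup>i\<^sup>t, e\<^sup>-\<^sup>i\<^sup>t, e\<^sup>-\<^sup>i\<^sup>t\<close> on
  the upper line and \<open>e\<^sup>i\<^sup>t, e\<^sup>i\<^sup>t, -e\<^sup>-\<^sup>i\<^sup>t, -e\<^sup>-\<^sup>i\<^sup>t\<close> on the lower one.\<close>

lemma phi_top_bowl_1:
  assumes "0 \<le> t" "t \<le> pi"
  shows "phi (top_bowl 1 t) = vector [t, 0, t]"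
proof -
  have "cis (-t) * cis t + cis (-t) * cis t + cis (-t) * cis (- (-t + t + t)) + cis t * cis t
      + cis t * cis (- (-t + t + t)) + cis t * cis (- (-t + t + t)) =
      complex_of_real (4 + 2 * cos (2*t))"
    unfolding cis_mult complex_eq_iff by simp
  from phi1_R3_point[OF this] have "top_bowl 1 t = phi1 (vector [-t, t, t])"
    by (simp add: top_bowl_1)
  moreover have "vector [-t, t, t] \<in> R'_set"
    using assms by (simp add: R'_set_def Let_def)
  ultimately show ?thesis
    by (simp add: phi_phi1 T_map_def Let_def)
qed

lemma phi_lower_bowl_1:
  assumes "-(pi/2) \<le> t" "t \<le> pi/2"
  shows "phi (lower_bowl 1 (-t)) = vector [0, - (sqrt 2 * t), pi]"
proof -
  have "cis t * cis t + cis t * cis (pi - t) + cis t * cis (- (t + t + (pi - t)))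
      + cis t * cis (pi - t) + cis t * cis (- (t + t + (pi - t)))
      + cis (pi - t) * cis (- (t + t + (pi - t))) =
      complex_of_real (-4 + 2 * cos (2*t))"
    unfolding cis_mult complex_eq_iff
    by (simp add: cos_diff[of "- (2*t)" "2*pi"] cos_minus[of "2*t"])
  from phi1_R3_point[OF this] have "lower_bowl 1 (-t) = phi1 (vector [t, t, pi - t])"
    by (simp add: lower_bowl_1)
  moreover have "vector [t, t, pi - t] \<in> R'_set"
    using assms by (simp add: R'_set_def Let_def)
  ultimately show ?thesis
    using real_div_sqrt[of 2]
    by (simp add: phi_phi1 T_map_def Let_def times_divide_eq_left[symmetric] del: times_divide_eq_left)
qed

text \<open>The parameter of the upper line matters only through its cosine, so \<open>[0, \<pi>]\<close> suffices, where
  \<open>\<phi>\<close> is known. For the lower line the sine plays this role, on \<open>[-\<pi>/2, \<pi>/2]\<close>.\<close>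

lemma phi_upper_line: "phi ` upper_line = closed_segment 0 A2"
proof -
  have "top_bowl 1 \<theta> = top_bowl 1 (arccos (cos \<theta>))" for \<theta>
    by (simp add: top_bowl_1 cos_double_cos)
  then have upper: "upper_line = top_bowl 1 ` {0..pi}"
    unfolding upper_line_def
    by (auto simp: arccos_lbound arccos_ubound intro!: image_eqI[of _ _ "arccos (cos _)"])
  have "phi ` upper_line = (\<lambda>t. vector [t, 0, t]) ` {0..pi}"
    unfolding upper image_image by (rule image_cong) (simp_all add: phi_top_bowl_1)
  also have "\<dots> = closed_segment 0 A2"
  proof (intro equalityI subsetI)
    fix q :: "real^3" assume "q \<in> (\<lambda>t. vector [t, 0, t]) ` {0..pi}"
    then obtain t where "0 \<le> t" "t \<le> pi" "q = vector [t, 0, t]" by auto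
    then show "q \<in> closed_segment 0 A2"
      unfolding in_segment
      by (intro exI[of _ "t / pi"]) (simp add: vec_eq_iff forall_3)
  next
    fix q assume "q \<in> closed_segment 0 A2"
    then obtain u where "0 \<le> u" "u \<le> 1" "q = u *\<^sub>R A2"
      by (auto simp: in_segment)
    then show "q \<in> (\<lambda>t. vector [t, 0, t]) ` {0..pi}"
      by (intro image_eqI[of _ _ "u * pi"]) (simp_all add: vec_eq_iff forall_3)
  qed
  finally show ?thesis .
qed

lemma phi_lower_line: "phi ` lower_line = closed_segment A1 A3"
proof -
  have "lower_bowl 1 \<theta> = lower_bowl 1 (- arcsin (- sin \<theta>))" for \<theta>
    by (simp add: lower_bowl_1 cos_double_sin)
  then have lower: "lower_line = (\<lambda>t. lower_bowl 1 (-t)) ` {-(pi/2)..pi/2}"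
    unfolding lower_line_def
    using arcsin_lbound arcsin_ubound
    by (auto intro!: image_eqI[of _ _ "arcsin (- sin _)"] simp del: arcsin_minus)
  have "phi ` lower_line = (\<lambda>t. vector [0, - (sqrt 2 * t), pi]) ` {-(pi/2)..pi/2}"
    unfolding lower image_image by (rule image_cong) (simp_all add: phi_lower_bowl_1)
  also have "\<dots> = closed_segment A1 A3"
  proof (intro equalityI subsetI)
    fix q :: "real^3" assume "q \<in> (\<lambda>t. vector [0, - (sqrt 2 * t), pi]) ` {-(pi/2)..pi/2}"
    then obtain t where "-(pi/2) \<le> t" "t \<le> pi/2" "q = vector [0, - (sqrt 2 * t), pi]" by auto
    then show "q \<in> closed_segment A1 A3"
      unfolding in_segment
      by (intro exI[of _ "1/2 - t / pi"]) (simp add: vec_eq_iff forall_3 field_simps)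
  next
    fix q assume "q \<in> closed_segment A1 A3"
    then obtain u where "0 \<le> u" "u \<le> 1" "q = (1 - u) *\<^sub>R A1 + u *\<^sub>R A3"
      by (auto simp: in_segment)
    moreover have "pi / sqrt 2 = sqrt 2 * (pi/2)"
      by (simp add: field_simps)
    ultimately show "q \<in> (\<lambda>t. vector [0, - (sqrt 2 * t), pi]) ` {-(pi/2)..pi/2}"
      by (intro image_eqI[of _ _ "(1/2 - u) * pi"]) (simp_all add: vec_eq_iff forall_3 algebra_simps)
  qed
  finally show ?thesis .
qed

theorem proposition5p6:
  shows "(\<forall>\<theta>. \<exists>p\<in>moebius_boundary. ((\<lambda>r. embed_C3 (top_bowl r \<theta>)) \<longlongrightarrow> p) at_top) \<and>
         (\<forall>\<theta>. \<exists>p\<in>moebius_boundary. ((\<lambda>r. embed_C3 (lower_bowl r \<theta>)) \<longlongrightarrow> p) at_top) \<and>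
         sqrt3_sqrt3_2_tetrahedron R_set \<and>
         phi ` upper_line \<noteq> phi ` lower_line \<and>
         {phi ` upper_line, phi ` lower_line} = longest_edges R_set"
proof (intro conjI allI)
  have "0 \<notin> closed_segment A1 A3"
    by (auto simp: in_segment vec_eq_iff forall_3 algebra_simps)
  then show "phi ` upper_line \<noteq> phi ` lower_line"
    unfolding phi_upper_line phi_lower_line by (metis ends_in_segment(1))
qed (simp_all only: bowls_tend_to_moebius_boundary sqrt3_sqrt3_2_tetrahedron_R_set
    phi_upper_line phi_lower_line longest_edges_R_set)

end
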